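(* Let $\mathbf{k}$ be a field, let $n$ be a positive integer, and let $X=\{x_1,\ldots,x_n\}$. With $\widetilde{S}$, $Irr(\widetilde{S})$ and the monoid $S_n(Sym_n)$ as defined in the context, the set $$Irr(\widetilde{S})=\Bigl(X^*\setminus\bigcup_{\sigma\in Sym_n}X^*\{\mathbf{x}_\sigma\}X^*\Bigr)\ \cup\ \bigl\{x_1^{m_1}\mathbf{x}_\varepsilon x_2^{m_2}\cdots x_n^{m_n}\ \big|\ m_i\ge 0,\ i=1,2,\ldots,n\bigr\}$$ is a $\mathbf{k}$-linear basis of the algebra $\mathbf{k}[S_n(Sym_n)]$ (via the images of these words). Moreover, $Irr(\widetilde{S})$ is a set of normal forms of the elements of the monoid $S_n(Sym_n)$, i.e. every element of $S_n(Sym_n)$ is represented by exactly one word in $Irr(\widetilde{S})$.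
   Context: $Sym_n$ is the symmetric group of degree $n$, $\varepsilon$ is its identity, and $Sym_n^0=Sym_n\setminus\{\varepsilon\}$. $X^*$ is the free monoid on $X$ and $\mathbf{k}\langle X\rangle$ is the free associative (unital) $\mathbf{k}$-algebra on $X$. For $\sigma\in Sym_n$ put $\mathbf{x}_\sigma=x_{\sigma(1)}x_{\sigma(2)}\cdots x_{\sigma(n)}\in X^*$; in particular $\mathbf{x}_\varepsilon=x_1x_2\cdots x_n$. Here $X^*\{\mathbf{x}_\sigma\}X^*$ is the set of words containing $\mathbf{x}_\sigma$ as a contiguous subword, and the $m_i$ are integers. The monoid $S_n(Sym_n)$ is given by the presentation $$S_n(Sym_n)=\langle x_1,\ldots,x_n\mid \mathbf{x}_\sigma=\mathbf{x}_\varepsilon,\ \sigma\in Sym_n\rangle,$$ and $\mathbf{k}[S_n(Sym_n)]$ is its monoid algebra over $\mathbf{k}$. $X^*$ is ordered by the degree-lexicographic order (compare lengths first, then lexicographically) with $x_1<x_2<\cdots<x_n$, and $\bar f$ denotes the leading (largest) word of a nonzero $f\in\mathbf{k}\langle X\rangle$. For letters $x_{i_1},\ldots,x_{i_m}\in X$ with $m\ge 2$, $\underline{x_{i_1}x_{i_2}\cdots x_{i_m}}$ denotes the word $x_{j_1}x_{j_2}\cdots x_{j_m}$, where $j_1\le j_2\le\cdots\le j_m$ is the rearrangement of $i_1,\ldots,i_m$ in non-decreasing order. $\widetilde{S}$ is the set of all the following polynomials, for all $\sigma\in Sym_n^0$, all $m\ge 1$, and all $2\le i,i_1,i_2,\ldots,i_{m+1}\le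 n$: 1. $\mathbf{x}_\sigma-\mathbf{x}_\varepsilon$; 2. $x_i\mathbf{x}_\varepsilon-\mathbf{x}_\varepsilon x_i$; 3. $x_ix_1^m\mathbf{x}_\varepsilon-x_1^m\mathbf{x}_\varepsilon x_i$; 4. $\mathbf{x}_\varepsilon x_{i_1}x_{i_2}\cdots x_{i_{m+1}}-\mathbf{x}_\varepsilon\,\underline{x_{i_1}x_{i_2}\cdots x_{i_{m+1}}}$, whenever $x_{i_1}x_{i_2}\cdots x_{i_{m+1}}>\underline{x_{i_1}x_{i_2}\cdots x_{i_{m+1}}}$; 5. $\mathbf{x}_\varepsilon x_{i_1}x_{i_2}\cdots x_{i_m}x_1-x_1\mathbf{x}_\varepsilon x_{i_1}x_{i_2}\cdots x_{i_m}$. $Irr(\widetilde{S})=\{u\in X^*\mid u\ne a\bar s b \text{ for all } s\in\widetilde{S},\ a,b\in X^*\}$. *)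

theory Defs
  imports
    Complex_Main
    "HOL-Combinatorics.Permutations"
    "HOL-Library.List_Lenlexorder"
    "HOL-Library.Poly_Mapping"
    "HOL-Algebra.Module"
begin

section \<open>Monoids given by generators and relations\<close>

definition free_monoid :: "'a set \<Rightarrow> 'a list monoid" where
  "free_monoid X = \<lparr>carrier = lists X, monoid.mult = (@), one = []\<rparr>"

text \<open>The least congruence of the free monoid on \<^term>\<open>X\<close> containing \<^term>\<open>R\<close>.\<close>

inductive_set cong_gen :: "'a set \<Rightarrow> ('a list \<times> 'a list) set \<Rightarrow> ('a list \<times> 'a list) set"
  for X :: "'a set" and R :: "('a list \<times> 'a list) set" where
  base: "\<lbrakk>(u, v) \<in> R; u \<in> lists X; v \<in> lists X\<rbrakk> \<Longrightarrow> (u, v) \<in> cong_gen X R"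
| refl: "u \<in> lists X \<Longrightarrow> (u, u) \<in> cong_gen X R"
| sym: "(u, v) \<in> cong_gen X R \<Longrightarrow> (v, u) \<in> cong_gen X R"
| trans: "\<lbrakk>(u, v) \<in> cong_gen X R; (v, w) \<in> cong_gen X R\<rbrakk> \<Longrightarrow> (u, w) \<in> cong_gen X R"
| mult: "\<lbrakk>(u, v) \<in> cong_gen X R; (u', v') \<in> cong_gen X R\<rbrakk> \<Longrightarrow> (u @ u', v @ v') \<in> cong_gen X R"

definition word_class :: "'a set \<Rightarrow> ('a list \<times> 'a list) set \<Rightarrow> 'a list \<Rightarrow> 'a list set" where
  "word_class X R u = cong_gen X R `` {u}"

definition presented_monoid :: "'a set \<Rightarrow> ('a list \<times> 'a list) set \<Rightarrow> 'a list set monoid" where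
  "presented_monoid X R =
     \<lparr>carrier = lists X // cong_gen X R,
      monoid.mult = (\<lambda>A B. \<Union>u\<in>A. \<Union>v\<in>B. word_class X R (u @ v)),
      one = word_class X R []\<rparr>"

lemma cong_gen_lists: "(u, v) \<in> cong_gen X R \<Longrightarrow> u \<in> lists X \<and> v \<in> lists X"
  by (induction rule: cong_gen.induct) auto

lemma equiv_cong_gen: "equiv (lists X) (cong_gen X R)"
proof (rule equivI)
  show "cong_gen X R \<subseteq> lists X \<times> lists X" using cong_gen_lists by fast
  show "refl_on (lists X) (cong_gen X R)" by (auto intro!: refl_onI cong_gen.refl)
  show "sym (cong_gen X R)" by (auto intro: symI cong_gen.sym)
  show "trans (cong_gen X R)" by (auto intro: transI cong_gen.trans)
qed

lemma word_class_eq_iff: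
  "u \<in> lists X \<Longrightarrow> v \<in> lists X \<Longrightarrow> word_class X R u = word_class X R v \<longleftrightarrow> (u, v) \<in> cong_gen X R"
  unfolding word_class_def by (rule eq_equiv_class_iff[OF equiv_cong_gen])

lemma word_class_in_carrier:
  "u \<in> lists X \<Longrightarrow> word_class X R u \<in> carrier (presented_monoid X R)"
  by (auto simp: presented_monoid_def word_class_def intro: quotientI)

lemma presented_monoid_mult:
  assumes "u \<in> lists X" "v \<in> lists X"
  shows "word_class X R u \<otimes>\<^bsub>presented_monoid X R\<^esub> word_class X R v = word_class X R (u @ v)"
proof -
  have eq: "word_class X R (u' @ v') = word_class X R (u @ v)"
    if "u' \<in> word_class X R u" "v' \<in> word_class X R v" for u' v'
  proof -
    from that have "(u @ v, u' @ v') \<in> cong_gen X R"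
      by (auto simp: word_class_def intro: cong_gen.mult)
    then show ?thesis
      unfolding word_class_def by (rule equiv_class_eq[OF equiv_cong_gen, symmetric])
  qed
  have "u \<in> word_class X R u" "v \<in> word_class X R v"
    using cong_gen.refl[OF assms(1)] cong_gen.refl[OF assms(2)] by (simp_all add: word_class_def)
  with eq have "(\<Union>u'\<in>word_class X R u. \<Union>v'\<in>word_class X R v. word_class X R (u' @ v')) =
      word_class X R (u @ v)"
    by blast
  then show ?thesis by (simp add: presented_monoid_def)
qed

lemma presented_monoid_cases:
  assumes "a \<in> carrier (presented_monoid X R)"
  obtains u where "u \<in> lists X" "a = word_class X R u"
  using assms by (auto simp: presented_monoid_def word_class_def elim!: quotientE)

lemma monoid_free_monoid: "monoid (free_monoid X)"
  by (rule monoidI) (auto simp: free_monoid_def)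

lemma monoid_presented_monoid: "monoid (presented_monoid X R)"
proof -
  let ?M = "presented_monoid X R"
  have one: "\<one>\<^bsub>?M\<^esub> = word_class X R []" by (simp add: presented_monoid_def)
  show ?thesis
  proof (rule monoidI)
    show "\<one>\<^bsub>?M\<^esub> \<in> carrier ?M"
      unfolding one by (rule word_class_in_carrier) simp
  next
    fix x assume "x \<in> carrier ?M"
    then obtain u where u: "u \<in> lists X" "x = word_class X R u" by (rule presented_monoid_cases)
    show "\<one>\<^bsub>?M\<^esub> \<otimes>\<^bsub>?M\<^esub> x = x" "x \<otimes>\<^bsub>?M\<^esub> \<one>\<^bsub>?M\<^esub> = x"
      using presented_monoid_mult[of "[]" X u R] presented_monoid_mult[of u X "[]" R] u
      by (simp_all add: one)
  next
    fix x y assume "x \<in> carrier ?M" "y \<in> carrier ?M"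
    then obtain u v where uv: "u \<in> lists X" "x = word_class X R u" "v \<in> lists X" "y = word_class X R v"
      by (metis presented_monoid_cases)
    then show "x \<otimes>\<^bsub>?M\<^esub> y \<in> carrier ?M"
      using word_class_in_carrier[of "u @ v" X R] by (simp add: presented_monoid_mult)
    fix z assume "z \<in> carrier ?M"
    then obtain w where "w \<in> lists X" "z = word_class X R w" by (rule presented_monoid_cases)
    with uv show "x \<otimes>\<^bsub>?M\<^esub> y \<otimes>\<^bsub>?M\<^esub> z = x \<otimes>\<^bsub>?M\<^esub> (y \<otimes>\<^bsub>?M\<^esub> z)"
      by (simp add: presented_monoid_mult)
  qed
qed


section \<open>Monoid algebras\<close>

definition pm_scale :: "'k::field \<Rightarrow> ('m \<Rightarrow>\<^sub>0 'k) \<Rightarrow> ('m \<Rightarrow>\<^sub>0 'k)" where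
  "pm_scale c f = Poly_Mapping.map ((*) c) f"

text \<open>
  The elements of the monoid algebra are the finitely supported functions on the carrier of the
  monoid, with pointwise addition and scaling, and with convolution as product. The monoid
  element \<^term>\<open>a\<close> is embedded as \<^term>\<open>Poly_Mapping.single a 1\<close>. The algebra is a subspace of the
  vector space of all finitely supported functions on the underlying type.
\<close>

definition monoid_algebra :: "('m, 'x) monoid_scheme \<Rightarrow> ('k::field, 'm \<Rightarrow>\<^sub>0 'k) module" where
  "monoid_algebra M =
     \<lparr>carrier = {f. Poly_Mapping.keys f \<subseteq> carrier M},
      monoid.mult = (\<lambda>f g. \<Sum>a\<in>Poly_Mapping.keys f. \<Sum>b\<in>Poly_Mapping.keys g.
                Poly_Mapping.single (a \<otimes>\<^bsub>M\<^esub> b) (Poly_Mapping.lookup f a * Poly_Mapping.lookup g b)),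
      one = Poly_Mapping.single \<one>\<^bsub>M\<^esub> 1,
      zero = 0,
      add = (+),
      smult = pm_scale\<rparr>"

lemma lookup_pm_scale: "Poly_Mapping.lookup (pm_scale c f) a = c * Poly_Mapping.lookup f a"
  by (simp add: pm_scale_def Poly_Mapping.map.rep_eq when_def)

global_interpretation pm: vector_space pm_scale
  by standard (auto intro!: poly_mapping_eqI simp: lookup_pm_scale lookup_add algebra_simps)

lemma subspace_monoid_algebra: "pm.subspace (carrier (monoid_algebra M))"
proof (rule pm.subspaceI)
  fix f g :: "'b \<Rightarrow>\<^sub>0 'a" and c :: 'a
  assume f: "f \<in> carrier (monoid_algebra M)" and g: "g \<in> carrier (monoid_algebra M)"
  have "Poly_Mapping.keys (pm_scale c f) \<subseteq> Poly_Mapping.keys f"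
    by (auto simp: in_keys_iff lookup_pm_scale)
  with f show "pm_scale c f \<in> carrier (monoid_algebra M)"
    by (auto simp: monoid_algebra_def)
  from f g show "f + g \<in> carrier (monoid_algebra M)"
    using Poly_Mapping.keys_add[of f g] by (auto simp: monoid_algebra_def)
qed (simp add: monoid_algebra_def)

lemma ring_monoid_algebra:
  assumes "monoid M"
  shows "ring (monoid_algebra M :: ('k::field, 'm \<Rightarrow>\<^sub>0 'k) module)"
proof -
  interpret monoid M by fact
  define A :: "('k, 'm \<Rightarrow>\<^sub>0 'k) module" where "A = monoid_algebra M"
  define conv :: "('m \<Rightarrow>\<^sub>0 'k) \<Rightarrow> ('m \<Rightarrow>\<^sub>0 'k) \<Rightarrow> ('m \<Rightarrow>\<^sub>0 'k)" where
    "conv = (\<lambda>f g. \<Sum>a\<in>Poly_Mapping.keys f. \<Sum>b\<in>Poly_Mapping.keys g.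
                Poly_Mapping.single (a \<otimes>\<^bsub>M\<^esub> b) (Poly_Mapping.lookup f a * Poly_Mapping.lookup g b))"
  have A: "carrier A = {f. Poly_Mapping.keys f \<subseteq> carrier M}" "mult A = conv"
    "one A = Poly_Mapping.single \<one>\<^bsub>M\<^esub> 1" "zero A = 0" "add A = (+)"
    by (simp_all add: A_def monoid_algebra_def conv_def)
  have conv_super: "conv f g = (\<Sum>a\<in>F. \<Sum>b\<in>G.
      Poly_Mapping.single (a \<otimes>\<^bsub>M\<^esub> b) (Poly_Mapping.lookup f a * Poly_Mapping.lookup g b))"
    if "Poly_Mapping.keys f \<subseteq> F" "Poly_Mapping.keys g \<subseteq> G" "finite F" "finite G" for f g F G
  proof -
    have "conv f g = (\<Sum>a\<in>Poly_Mapping.keys f. \<Sum>b\<in>G.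
      Poly_Mapping.single (a \<otimes>\<^bsub>M\<^esub> b) (Poly_Mapping.lookup f a * Poly_Mapping.lookup g b))"
      unfolding conv_def using that
      by (intro sum.cong refl sum.mono_neutral_left) (auto simp: in_keys_iff)
    also have "\<dots> = (\<Sum>a\<in>F. \<Sum>b\<in>G.
      Poly_Mapping.single (a \<otimes>\<^bsub>M\<^esub> b) (Poly_Mapping.lookup f a * Poly_Mapping.lookup g b))"
      using that by (intro sum.mono_neutral_left) (auto simp: in_keys_iff)
    finally show ?thesis .
  qed
  have conv_add_left: "conv (f + g) h = conv f h + conv g h" for f g h
    using Poly_Mapping.keys_add[of f g]
    by (subst (1 2 3) conv_super[where F = "Poly_Mapping.keys f \<union> Poly_Mapping.keys g" and G = "Poly_Mapping.keys h"])
       (auto simp: lookup_add distrib_right single_add sum.distrib)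
  have conv_add_right: "conv h (f + g) = conv h f + conv h g" for f g h
    using Poly_Mapping.keys_add[of f g]
    by (subst (1 2 3) conv_super[where F = "Poly_Mapping.keys h" and G = "Poly_Mapping.keys f \<union> Poly_Mapping.keys g"])
       (auto simp: lookup_add distrib_left single_add sum.distrib)
  have conv_0: "conv 0 h = 0" "conv h 0 = 0" for h
    by (simp_all add: conv_def)
  have conv_sum_left: "conv (sum F I) h = (\<Sum>i\<in>I. conv (F i) h)" for F h and I :: "'m set"
    by (induction I rule: infinite_finite_induct) (auto simp: conv_0 conv_add_left)
  have conv_sum_right: "conv h (sum F I) = (\<Sum>i\<in>I. conv h (F i))" for F h and I :: "'m set"
    by (induction I rule: infinite_finite_induct) (auto simp: conv_0 conv_add_right)
  have conv_single: "conv (Poly_Mapping.single a x) (Poly_Mapping.single b y) =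
      Poly_Mapping.single (a \<otimes>\<^bsub>M\<^esub> b) (x * y)" for a b x y
    by (subst conv_super[where F = "{a}" and G = "{b}"]) auto
  have expand: "f = (\<Sum>a\<in>Poly_Mapping.keys f. Poly_Mapping.single a (Poly_Mapping.lookup f a))" for f :: "'m \<Rightarrow>\<^sub>0 'k"
    by (intro poly_mapping_eqI)
       (auto simp: lookup_sum lookup_single when_def in_keys_iff)
  have closed: "Poly_Mapping.keys (conv f g) \<subseteq> carrier M"
    if "Poly_Mapping.keys f \<subseteq> carrier M" "Poly_Mapping.keys g \<subseteq> carrier M" for f g
  proof -
    have "Poly_Mapping.keys (conv f g) \<subseteq> (\<Union>a\<in>Poly_Mapping.keys f. \<Union>b\<in>Poly_Mapping.keys g. {a \<otimes>\<^bsub>M\<^esub> b})"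
      unfolding conv_def
      by (rule order_trans[OF Poly_Mapping.keys_sum] UN_mono order_refl)+ auto
    with that show ?thesis by blast
  qed
  have assoc: "conv (conv f g) h = conv f (conv g h)"
    if "Poly_Mapping.keys f \<subseteq> carrier M" "Poly_Mapping.keys g \<subseteq> carrier M" "Poly_Mapping.keys h \<subseteq> carrier M" for f g h
  proof -
    let ?s = "\<lambda>f a. Poly_Mapping.single a (Poly_Mapping.lookup f a) :: 'm \<Rightarrow>\<^sub>0 'k"
    have "conv (conv f g) h =
        conv (conv (\<Sum>a\<in>Poly_Mapping.keys f. ?s f a) (\<Sum>b\<in>Poly_Mapping.keys g. ?s g b)) (\<Sum>c\<in>Poly_Mapping.keys h. ?s h c)"
      by (simp only: expand[symmetric])
    also have "\<dots> = (\<Sum>c\<in>Poly_Mapping.keys h. \<Sum>b\<in>Poly_Mapping.keys g. \<Sum>a\<in>Poly_Mapping.keys f. conv (conv (?s f a) (?s g b)) (?s h c))"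
      by (simp only: conv_sum_left conv_sum_right)
    also have "\<dots> = (\<Sum>c\<in>Poly_Mapping.keys h. \<Sum>b\<in>Poly_Mapping.keys g. \<Sum>a\<in>Poly_Mapping.keys f. conv (?s f a) (conv (?s g b) (?s h c)))"
      using that by (intro sum.cong refl) (auto simp: conv_single m_assoc subset_iff mult.assoc)
    also have "\<dots> =
        conv (\<Sum>a\<in>Poly_Mapping.keys f. ?s f a) (conv (\<Sum>b\<in>Poly_Mapping.keys g. ?s g b) (\<Sum>c\<in>Poly_Mapping.keys h. ?s h c))"
      by (simp only: conv_sum_left conv_sum_right)
    also have "\<dots> = conv f (conv g h)" by (simp only: expand[symmetric])
    finally show ?thesis .
  qed
  have one_left: "conv (Poly_Mapping.single \<one>\<^bsub>M\<^esub> 1) f = f" if "Poly_Mapping.keys f \<subseteq> carrier M" for f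
  proof -
    have "conv (Poly_Mapping.single \<one>\<^bsub>M\<^esub> 1) f =
      (\<Sum>a\<in>Poly_Mapping.keys f. conv (Poly_Mapping.single \<one>\<^bsub>M\<^esub> 1) (Poly_Mapping.single a (Poly_Mapping.lookup f a)))"
      by (subst expand[of f]) (rule conv_sum_right)
    also have "\<dots> = (\<Sum>a\<in>Poly_Mapping.keys f. Poly_Mapping.single a (Poly_Mapping.lookup f a))"
      using that by (intro sum.cong refl) (auto simp: conv_single subset_iff)
    finally show ?thesis by (simp only: expand[symmetric])
  qed
  have one_right: "conv f (Poly_Mapping.single \<one>\<^bsub>M\<^esub> 1) = f" if "Poly_Mapping.keys f \<subseteq> carrier M" for f
  proof -
    have "conv f (Poly_Mapping.single \<one>\<^bsub>M\<^esub> 1) =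
      (\<Sum>a\<in>Poly_Mapping.keys f. conv (Poly_Mapping.single a (Poly_Mapping.lookup f a)) (Poly_Mapping.single \<one>\<^bsub>M\<^esub> 1))"
      by (subst expand[of f]) (rule conv_sum_left)
    also have "\<dots> = (\<Sum>a\<in>Poly_Mapping.keys f. Poly_Mapping.single a (Poly_Mapping.lookup f a))"
      using that by (intro sum.cong refl) (auto simp: conv_single subset_iff)
    finally show ?thesis by (simp only: expand[symmetric])
  qed
  have "ring A"
  proof (rule ringI)
    show "abelian_group A"
    proof (rule abelian_groupI)
      fix x assume x: "x \<in> carrier A"
      show "\<exists>y\<in>carrier A. y \<oplus>\<^bsub>A\<^esub> x = \<zero>\<^bsub>A\<^esub>"
        by (rule bexI[of _ "- x"]) (use x in \<open>auto simp: A\<close>)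
    next
      fix x y assume "x \<in> carrier A" "y \<in> carrier A"
      then show "x \<oplus>\<^bsub>A\<^esub> y \<in> carrier A"
        using Poly_Mapping.keys_add[of x y] by (auto simp: A)
    qed (simp_all add: A add.assoc add.commute)
    show "monoid A"
    proof (rule monoidI)
      fix x y assume "x \<in> carrier A" "y \<in> carrier A"
      then show "x \<otimes>\<^bsub>A\<^esub> y \<in> carrier A" unfolding A using closed by blast
    qed (simp_all add: A one_left one_right assoc)
  qed (simp_all add: A conv_add_left conv_add_right)
  then show ?thesis unfolding A_def .
qed


section \<open>The monoid of the symmetric group\<close>

text \<open>
  The letter $x_i$ is the number \<^term>\<open>i\<close>, so the alphabet is \<^term>\<open>{1..n::nat}\<close>. Words carry
  the degree-lexicographic order of \<^theory>\<open>HOL-Library.List_Lenlexorder\<close>.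
\<close>

definition x_word :: "nat \<Rightarrow> (nat \<Rightarrow> nat) \<Rightarrow> nat list" where
  "x_word n \<sigma> = map \<sigma> [1..<Suc n]"

abbreviation x_eps :: "nat \<Rightarrow> nat list" where
  "x_eps n \<equiv> x_word n id"

definition sym_relations :: "nat \<Rightarrow> (nat list \<times> nat list) set" where
  "sym_relations n = {(x_word n \<sigma>, x_eps n) | \<sigma>. \<sigma> permutes {1..n}}"

definition Sn_Sym :: "nat \<Rightarrow> nat list set monoid" where
  "Sn_Sym n = presented_monoid {1..n} (sym_relations n)"

definition Sn_class :: "nat \<Rightarrow> nat list \<Rightarrow> nat list set" where
  "Sn_class n u = word_class {1..n} (sym_relations n) u"

abbreviation mon :: "'a \<Rightarrow> ('a \<Rightarrow>\<^sub>0 'k::field)" where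
  "mon u \<equiv> Poly_Mapping.single u 1"

text \<open>
  The five families are the ones of the definition of $\widetilde{S}$, in that order; \<^term>\<open>w\<close>
  stands for $x_{i_1}\cdots x_{i_{m+1}}$ in the fourth and $x_{i_1}\cdots x_{i_m}$ in the fifth.
\<close>

definition S_tilde :: "nat \<Rightarrow> (nat list \<Rightarrow>\<^sub>0 'k::field) set" where
  "S_tilde n =
     {mon (x_word n \<sigma>) - mon (x_eps n) | \<sigma>. \<sigma> permutes {1..n} \<and> \<sigma> \<noteq> id} \<union>
     {mon ([i] @ x_eps n) - mon (x_eps n @ [i]) | i. i \<in> {2..n}} \<union>
     {mon ([i] @ replicate m 1 @ x_eps n) - mon (replicate m 1 @ x_eps n @ [i])
        | i m. i \<in> {2..n} \<and> m \<ge> 1} \<union>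
     {mon (x_eps n @ w) - mon (x_eps n @ sort w)
        | w. w \<in> lists {2..n} \<and> length w \<ge> 2 \<and> w > sort w} \<union>
     {mon (x_eps n @ w @ [1]) - mon ([1] @ x_eps n @ w)
        | w. w \<in> lists {2..n} \<and> length w \<ge> 1}"

definition leading_word :: "(nat list \<Rightarrow>\<^sub>0 'k::field) \<Rightarrow> nat list" where
  "leading_word f = Max (Poly_Mapping.keys f)"

definition Irr :: "nat \<Rightarrow> (nat list \<Rightarrow>\<^sub>0 'k::field) set \<Rightarrow> nat list set" where
  "Irr n S = {u \<in> lists {1..n}.
     \<forall>s\<in>S. \<forall>a\<in>lists {1..n}. \<forall>b\<in>lists {1..n}. u \<noteq> a @ leading_word s @ b}"

lemma x_word_in_lists:
  assumes "\<sigma> permutes {1..n}"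
  shows "x_word n \<sigma> \<in> lists {1..n}"
proof -
  have "set (x_word n \<sigma>) = \<sigma> ` {1..n}"
    by (simp only: x_word_def set_map set_upt atLeastLessThanSuc_atLeastAtMost)
  also have "\<dots> = {1..n}" by (rule permutes_image[OF assms])
  finally show ?thesis by (simp only: in_lists_conv_set) blast
qed

lemma S_tilde_subset:
  "S_tilde n \<subseteq> carrier (monoid_algebra (free_monoid {1..n}) :: ('k::field, _) module)"
proof -
  have diff: "mon u - mon v \<in> carrier (monoid_algebra (free_monoid {1..n}) :: ('k, _) module)"
    if "u \<in> lists {1..n}" "v \<in> lists {1..n}" for u v
    using that
    by (intro pm.subspace_diff[OF subspace_monoid_algebra])
       (auto simp: monoid_algebra_def free_monoid_def)
  have eps: "x_eps n \<in> lists {1..n}" by (rule x_word_in_lists) (rule permutes_id)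
  have rep: "replicate m (Suc 0) \<in> lists {Suc 0..n}" if "2 \<le> i \<and> i \<le> n" for m i
    using that by (auto simp: in_lists_conv_set)
  have letter: "w \<in> lists {1..n}" if "set w \<subseteq> {2..n}" for w
    using subset_trans[OF that, of "{1..n}"] by (simp add: lists_eq_set)
  show ?thesis
    unfolding S_tilde_def
  proof (intro Un_least subsetI; elim CollectE exE conjE; hypsubst; rule diff)
    fix \<sigma> assume "\<sigma> permutes {1..n}"
    then show "x_word n \<sigma> \<in> lists {1..n}" by (rule x_word_in_lists)
  next
    fix w assume "w \<in> lists {2..n}"
    then have "set w \<subseteq> {2..n}" by (simp add: lists_eq_set)
    note w = letter[OF this] this
    show "x_eps n @ w \<in> lists {1..n}" "x_eps n @ sort w \<in> lists {1..n}"
      using eps w letter[of "sort w"] by (simp_all del: in_lists_conv_set)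
    assume "1 \<le> length w"
    with w have "1 \<in> {1..n}" by (cases w) auto
    with w eps show "x_eps n @ w @ [1] \<in> lists {1..n}" "[1] @ x_eps n @ w \<in> lists {1..n}"
      by simp_all
  qed (use eps rep in \<open>simp_all\<close>)
qed

end

theory Submission
  imports Defs
begin

text \<open>
  Write $z$ for \<^term>\<open>x_eps n\<close>, and call a word over the alphabet a permutation word if every
  letter occurs in it exactly once; these are the words \<^term>\<open>x_word n \<sigma>\<close>, and all of them are
  identified with $z$ in the monoid. The theorem rests on two opposite observations.

  The relations identify much. If $p$ lists the letters other than $i$, then $ip$ and $pi$ are
  permutation words, so $iz = i(pi) = (ip)i = zi$: the element $z$ is central
  (\<open>x_eps_commutes_letter\<close>). If $p$ lists the letters other than $i$ and $j$, then
  $zij = ijz = ij(pij) = (ijp)ij = (jip)ij = ji(pij) = jiz = zji$ (\<open>x_eps_swap_letters\<close>), so behind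
  a factor $z$ all letters commute. Hence a word with a permutation factor can be brought into the
  form $1^k z w$, where $w$ is sorted and does not contain the letter $1$
  (\<open>cong_sorted_normal_form\<close>).

  The relations identify nothing else. Applying one of them to a word requires a permutation
  factor, leaves such a factor behind and does not change the multiset of the letters. So distinct
  congruent words both have a permutation factor, and the same letters (\<open>Sn_cong_cases\<close>). A word
  without permutation factor is therefore alone in its class, while $1^k z w$ with $w$ as above is
  determined by its multiset of letters. Therefore the words without permutation factor, together
  with the words $1^k z w$, represent every class exactly once.

  It remains to identify these words with the irreducible ones (\<open>Irr_S_tilde_eq\<close>). The leading word
  of each polynomial has a permutation factor, so that words without one are irreducible. If a word
  $azb$ avoids the leading words, then the second and third family force $a$ to be a power of
  $1$; for $n \ge 2$ the fifth (with the first) forces $b$ not to contain $1$, and the fourth forces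
  $b$ to be sorted, while for $n = 1$ all words are powers of $1$. The linear basis is then
  the basis of a monoid algebra that consists of the elements of the monoid.
\<close>

section \<open>Permutation words\<close>

lemma mset_x_eps: "mset (x_eps n) = mset_set {1..n}"
  by (simp add: x_word_def atLeastLessThanSuc_atLeastAtMost del: upt_Suc)

lemma x_eps_Cons: "n \<ge> 1 \<Longrightarrow> x_eps n = 1 # [2..<Suc n]"
  by (simp add: x_word_def upt_conv_Cons numeral_2_eq_2 del: upt_Suc)

lemma mset_x_word:
  assumes "\<sigma> permutes {1..n}"
  shows "mset (x_word n \<sigma>) = mset_set {1..n}"
proof -
  have "mset (x_word n \<sigma>) = image_mset \<sigma> (mset_set {1..n})"
    by (simp add: x_word_def atLeastLessThanSuc_atLeastAtMost del: upt_Suc)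
  also have "\<dots> = mset_set (\<sigma> ` {1..n})"
    by (rule image_mset_mset_set) (rule permutes_inj_on[OF assms])
  also have "\<dots> = mset_set {1..n}" by (simp only: permutes_image[OF assms])
  finally show ?thesis .
qed

lemma permutation_word_is_x_word:
  assumes "mset w = mset_set {1..n}"
  obtains \<sigma> where "\<sigma> permutes {1..n}" "w = x_word n \<sigma>"
proof
  let ?\<sigma> = "\<lambda>i. if i \<in> {1..n} then w ! (i - 1) else i"
  have len: "length w = n" using arg_cong[OF assms, of size] by simp
  have set: "set w = {1..n}" using arg_cong[OF assms, of set_mset] by simp
  show w: "w = x_word n ?\<sigma>"
    by (rule nth_equalityI) (auto simp: x_word_def len simp del: upt_Suc)
  have "?\<sigma> ` {1..n} = set (x_word n ?\<sigma>)"
    by (simp only: x_word_def set_map set_upt atLeastLessThanSuc_atLeastAtMost)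
  then have img: "?\<sigma> ` {1..n} = {1..n}" unfolding w[symmetric] set .
  then have "inj_on ?\<sigma> {1..n}" by (intro eq_card_imp_inj_on) simp_all
  with img show "?\<sigma> permutes {1..n}"
    by (intro bij_imp_permutes) (auto simp only: bij_betw_def if_False)
qed

definition has_perm_factor :: "nat \<Rightarrow> nat list \<Rightarrow> bool" where
  "has_perm_factor n u \<longleftrightarrow> (\<exists>a w b. u = a @ w @ b \<and> mset w = mset_set {1..n})"

lemma has_perm_factor_append:
  assumes "has_perm_factor n u"
  shows "has_perm_factor n (a @ u @ b)"
proof -
  from assms obtain c w d where "u = c @ w @ d" "mset w = mset_set {1..n}"
    unfolding has_perm_factor_def by blast
  then have "a @ u @ b = (a @ c) @ w @ (d @ b)" "mset w = mset_set {1..n}" by simp_all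
  then show ?thesis unfolding has_perm_factor_def by blast
qed

lemma has_perm_factor_x_eps: "has_perm_factor n (a @ x_eps n @ b)"
  unfolding has_perm_factor_def using mset_x_eps by blast

lemma words_without_perm_factor:
  "lists {1..n} - (\<Union>\<sigma>\<in>{\<sigma>. \<sigma> permutes {1..n}}.
      {a @ x_word n \<sigma> @ b | a b. a \<in> lists {1..n} \<and> b \<in> lists {1..n}}) =
   {u \<in> lists {1..n}. \<not> has_perm_factor n u}" (is "_ - ?U = _")
proof -
  have "u \<in> ?U \<longleftrightarrow> has_perm_factor n u" if u: "u \<in> lists {1..n}" for u
  proof
    assume "u \<in> ?U"
    then show "has_perm_factor n u" unfolding has_perm_factor_def using mset_x_word by blast
  next
    assume "has_perm_factor n u"
    then obtain a w b where w: "u = a @ w @ b" "mset w = mset_set {1..n}"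
      unfolding has_perm_factor_def by blast
    obtain \<sigma> where "\<sigma> permutes {1..n}" "w = x_word n \<sigma>"
      using w(2) by (rule permutation_word_is_x_word)
    moreover have "a \<in> lists {1..n}" "b \<in> lists {1..n}" using u w(1) by simp_all
    ultimately show "u \<in> ?U" using w(1) by blast
  qed
  then show ?thesis by blast
qed


section \<open>The congruence of the presentation\<close>

definition Sn_cong :: "nat list \<Rightarrow> nat \<Rightarrow> nat list \<Rightarrow> bool" (\<open>_ \<approx>\<^bsub>_\<^esub> _\<close> [51, 0, 51] 50) where
  "u \<approx>\<^bsub>n\<^esub> v \<longleftrightarrow> (u, v) \<in> cong_gen {1..n} (sym_relations n)"

lemma Sn_cong_refl: "u \<in> lists {1..n} \<Longrightarrow> u \<approx>\<^bsub>n\<^esub> u"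
  unfolding Sn_cong_def by (rule cong_gen.refl)

lemma Sn_cong_sym: "u \<approx>\<^bsub>n\<^esub> v \<Longrightarrow> v \<approx>\<^bsub>n\<^esub> u"
  unfolding Sn_cong_def by (rule cong_gen.sym)

lemma Sn_cong_trans [trans]: "u \<approx>\<^bsub>n\<^esub> v \<Longrightarrow> v \<approx>\<^bsub>n\<^esub> w \<Longrightarrow> u \<approx>\<^bsub>n\<^esub> w"
  unfolding Sn_cong_def by (rule cong_gen.trans)

lemma Sn_cong_append_left: "u \<approx>\<^bsub>n\<^esub> v \<Longrightarrow> a \<in> lists {1..n} \<Longrightarrow> a @ u \<approx>\<^bsub>n\<^esub> a @ v"
  unfolding Sn_cong_def by (rule cong_gen.mult[OF cong_gen.refl])

lemma Sn_cong_append_right: "u \<approx>\<^bsub>n\<^esub> v \<Longrightarrow> b \<in> lists {1..n} \<Longrightarrow> u @ b \<approx>\<^bsub>n\<^esub> v @ b"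
  unfolding Sn_cong_def by (rule cong_gen.mult[OF _ cong_gen.refl])

lemma x_eps_in_lists: "x_eps n \<in> lists {1..n}"
  by (rule x_word_in_lists) (rule permutes_id)

lemma permutation_words_cong:
  assumes "mset u = mset_set {1..n}" "mset v = mset_set {1..n}"
  shows "u \<approx>\<^bsub>n\<^esub> v"
proof -
  have eps: "w \<approx>\<^bsub>n\<^esub> x_eps n" if w: "mset w = mset_set {1..n}" for w
  proof -
    obtain \<sigma> where \<sigma>: "\<sigma> permutes {1..n}" "w = x_word n \<sigma>"
      using w by (rule permutation_word_is_x_word)
    then have "(w, x_eps n) \<in> sym_relations n" unfolding sym_relations_def by blast
    then show ?thesis
      unfolding Sn_cong_def \<sigma>(2) by (rule cong_gen.base) (intro x_word_in_lists \<sigma> permutes_id)+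
  qed
  show ?thesis by (rule Sn_cong_trans[OF eps[OF assms(1)] Sn_cong_sym[OF eps[OF assms(2)]]])
qed

text \<open>
  The two steps are the two ways of completing a word $p$ on the remaining letters to a
  permutation word, in $i(pi) = (ip)i$.
\<close>

lemma x_eps_commutes_letter:
  assumes "i \<in> {1..n}"
  shows "[i] @ x_eps n \<approx>\<^bsub>n\<^esub> x_eps n @ [i]"
proof -
  have "mset_set {1..n} = add_mset i (mset_set ({1..n} - {i}))"
    using assms by (intro mset_set.remove) simp_all
  then obtain p where p: "add_mset i (mset p) = mset_set {1..n}"
    by (metis ex_mset)
  have i: "[i] \<in> lists {1..n}" using assms by simp
  have "[i] @ x_eps n \<approx>\<^bsub>n\<^esub> [i] @ (p @ [i])"
    using p by (intro Sn_cong_append_left permutation_words_cong i) (simp_all only: mset_x_eps, simp)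
  also have "[i] @ (p @ [i]) = ([i] @ p) @ [i]" by simp
  also have "\<dots> \<approx>\<^bsub>n\<^esub> x_eps n @ [i]"
    using p by (intro Sn_cong_append_right permutation_words_cong i) (simp_all only: mset_x_eps, simp)
  finally show ?thesis .
qed

lemma x_eps_commutes:
  assumes "u \<in> lists {1..n}"
  shows "u @ x_eps n \<approx>\<^bsub>n\<^esub> x_eps n @ u"
  using assms
proof (induction u)
  case Nil
  show ?case using Sn_cong_refl[OF x_eps_in_lists] by (simp only: append_Nil append_Nil2)
next
  case (Cons i u)
  from Cons.hyps have i: "[i] \<in> lists {1..n}" by simp
  have "(i # u) @ x_eps n = [i] @ (u @ x_eps n)" by simp
  also have "\<dots> \<approx>\<^bsub>n\<^esub> [i] @ (x_eps n @ u)"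
    by (intro Sn_cong_append_left Cons.IH i)
  also have "[i] @ (x_eps n @ u) = ([i] @ x_eps n) @ u" by simp
  also have "\<dots> \<approx>\<^bsub>n\<^esub> (x_eps n @ [i]) @ u"
    by (intro Sn_cong_append_right x_eps_commutes_letter Cons.hyps)
  also have "\<dots> = x_eps n @ (i # u)" by simp
  finally show ?case .
qed

text \<open>
  Moving $z$ behind $ij$ and writing it as $pij$ makes the word $ijp$ visible, which is a permutation
  word too and can be replaced by $jip$.
\<close>

lemma x_eps_swap_letters:
  assumes "i \<in> {1..n}" "j \<in> {1..n}"
  shows "x_eps n @ [i, j] \<approx>\<^bsub>n\<^esub> x_eps n @ [j, i]"
proof (cases "i = j")
  case True
  with assms x_eps_in_lists[of n] show ?thesis unfolding True by (intro Sn_cong_refl) simp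
next
  case False
  have "mset_set {1..n} = add_mset i (mset_set ({1..n} - {i}))"
    using assms by (intro mset_set.remove) simp_all
  also have "mset_set ({1..n} - {i}) = add_mset j (mset_set ({1..n} - {i} - {j}))"
    using assms False by (intro mset_set.remove) simp_all
  finally obtain p where p: "add_mset i (add_mset j (mset p)) = mset_set {1..n}"
    by (metis ex_mset)
  have perm: "mset ([i, j] @ p) = mset_set {1..n}" "mset ([j, i] @ p) = mset_set {1..n}"
    "mset (p @ [i, j]) = mset_set {1..n}"
    using p by (simp_all add: add_mset_commute)
  have ij: "[i, j] \<in> lists {1..n}" "[j, i] \<in> lists {1..n}" using assms by simp_all
  have "x_eps n @ [i, j] \<approx>\<^bsub>n\<^esub> [i, j] @ x_eps n"
    by (intro Sn_cong_sym[OF x_eps_commutes] ij)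
  also have "\<dots> \<approx>\<^bsub>n\<^esub> [i, j] @ (p @ [i, j])"
    by (intro Sn_cong_append_left permutation_words_cong perm mset_x_eps ij)
  also have "[i, j] @ (p @ [i, j]) = ([i, j] @ p) @ [i, j]" by simp
  also have "\<dots> \<approx>\<^bsub>n\<^esub> ([j, i] @ p) @ [i, j]"
    by (intro Sn_cong_append_right permutation_words_cong perm ij)
  also have "\<dots> = [j, i] @ (p @ [i, j])" by simp
  also have "\<dots> \<approx>\<^bsub>n\<^esub> [j, i] @ x_eps n"
    by (intro Sn_cong_append_left permutation_words_cong perm mset_x_eps ij)
  also have "\<dots> \<approx>\<^bsub>n\<^esub> x_eps n @ [j, i]"
    by (intro x_eps_commutes ij)
  finally show ?thesis .
qed

text \<open>
  Swapping needs a factor $z$ in front. So a letter that has been passed goes in front of $z$, to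
  bring the next one next to $z$, and returns at the end.
\<close>

lemma x_eps_move_letter:
  assumes "i \<in> {1..n}" "u \<in> lists {1..n}"
  shows "x_eps n @ i # u \<approx>\<^bsub>n\<^esub> x_eps n @ u @ [i]"
  using assms(2)
proof (induction u)
  case Nil
  have "[i] \<in> lists {1..n}" using assms(1) by simp
  then show ?case
    unfolding append_Nil using x_eps_in_lists by (intro Sn_cong_refl) (simp only: append_in_lists_conv)
next
  case (Cons j u)
  from Cons.hyps assms(1) have j: "[j] \<in> lists {1..n}" and i: "[i] \<in> lists {1..n}" by simp_all
  have "x_eps n @ i # j # u = (x_eps n @ [i, j]) @ u" by simp
  also have "\<dots> \<approx>\<^bsub>n\<^esub> (x_eps n @ [j, i]) @ u"
    using Cons.hyps assms(1) by (intro Sn_cong_append_right x_eps_swap_letters)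
  also have "\<dots> = (x_eps n @ [j]) @ (i # u)" by simp
  also have "\<dots> \<approx>\<^bsub>n\<^esub> ([j] @ x_eps n) @ (i # u)"
    using Cons.hyps assms(1) by (intro Sn_cong_append_right Sn_cong_sym[OF x_eps_commutes] j) simp
  also have "\<dots> = [j] @ (x_eps n @ i # u)" by simp
  also have "\<dots> \<approx>\<^bsub>n\<^esub> [j] @ (x_eps n @ u @ [i])"
    by (intro Sn_cong_append_left Cons.IH j)
  also have "[j] @ (x_eps n @ u @ [i]) = ([j] @ x_eps n) @ (u @ [i])" by simp
  also have "\<dots> \<approx>\<^bsub>n\<^esub> (x_eps n @ [j]) @ (u @ [i])"
    using Cons.hyps assms(1) by (intro Sn_cong_append_right x_eps_commutes j) simp
  also have "\<dots> = x_eps n @ (j # u) @ [i]" by simp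
  finally show ?case .
qed

lemma x_eps_rearrange:
  assumes "mset u = mset v" "u \<in> lists {1..n}"
  shows "x_eps n @ u \<approx>\<^bsub>n\<^esub> x_eps n @ v"
  using assms
proof (induction u arbitrary: v)
  case Nil
  then have "v = []" by simp
  then show ?case using Sn_cong_refl[OF x_eps_in_lists] by (simp only: append_Nil2)
next
  case (Cons i u)
  have "i \<in> set v" using arg_cong[OF Cons.prems(1), of set_mset] by auto
  then obtain p q where v: "v = p @ i # q" by (meson split_list)
  from Cons.prems have i: "[i] \<in> lists {1..n}" and u: "u \<in> lists {1..n}" by simp_all
  have set: "set (i # u) = set v" using Cons.prems(1) by (rule mset_eq_setD)
  with Cons.prems(2) have pq: "p \<in> lists {1..n}" "q \<in> lists {1..n}"
    unfolding v in_lists_conv_set by auto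
  have "x_eps n @ (i # u) = (x_eps n @ [i]) @ u" by simp
  also have "\<dots> \<approx>\<^bsub>n\<^esub> ([i] @ x_eps n) @ u"
    by (intro Sn_cong_append_right Sn_cong_sym[OF x_eps_commutes] i u)
  also have "\<dots> = [i] @ (x_eps n @ u)" by simp
  also have "\<dots> \<approx>\<^bsub>n\<^esub> [i] @ (x_eps n @ (p @ q))"
    using Cons.prems(1) u by (intro Sn_cong_append_left Cons.IH i) (simp_all add: v)
  also have "\<dots> = ([i] @ x_eps n) @ (p @ q)" by simp
  also have "\<dots> \<approx>\<^bsub>n\<^esub> (x_eps n @ [i]) @ (p @ q)"
    using pq by (intro Sn_cong_append_right x_eps_commutes i) simp
  also have "\<dots> = (x_eps n @ i # p) @ q" by simp
  also have "\<dots> \<approx>\<^bsub>n\<^esub> (x_eps n @ p @ [i]) @ q"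
    using i pq by (intro Sn_cong_append_right x_eps_move_letter) simp_all
  also have "\<dots> = x_eps n @ v" by (simp add: v)
  finally show ?case .
qed

text \<open>
  The condition on the right defines a congruence that contains the relations, so it contains the
  least one.
\<close>

lemma Sn_cong_cases:
  assumes "u \<approx>\<^bsub>n\<^esub> v"
  shows "u = v \<or> has_perm_factor n u \<and> has_perm_factor n v \<and> mset u = mset v"
  using assms unfolding Sn_cong_def
proof (induction rule: cong_gen.induct)
  case (base u v)
  then obtain \<sigma> where "\<sigma> permutes {1..n}" "u = x_word n \<sigma>" "v = x_eps n"
    unfolding sym_relations_def by blast
  then have "mset u = mset_set {1..n}" "mset v = mset_set {1..n}"
    using mset_x_word mset_x_eps by simp_all
  moreover from this have "has_perm_factor n u" "has_perm_factor n v"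
    unfolding has_perm_factor_def by (metis append_Nil append_Nil2)+
  ultimately show ?case by simp
next
  case (mult u v u' v')
  have left: "has_perm_factor n (a @ b)" if "has_perm_factor n a" for a b
    using has_perm_factor_append[OF that, of "[]" b] by simp
  have right: "has_perm_factor n (a @ b)" if "has_perm_factor n b" for a b
    using has_perm_factor_append[OF that, of a "[]"] by simp
  from mult.IH show ?case by (auto intro: left right)
qed auto


section \<open>Words in sorted normal form\<close>

definition sorted_forms :: "nat \<Rightarrow> nat list set" where
  "sorted_forms n = {replicate k 1 @ x_eps n @ w | k w. w \<in> lists {2..n} \<and> sorted w}"

lemma lists_2_subset: "w \<in> lists {2..n::nat} \<Longrightarrow> w \<in> lists {1..n}"
  by (auto simp: in_lists_conv_set)

lemma sorted_forms_subset:
  assumes "n \<ge> 1"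
  shows "sorted_forms n \<subseteq> lists {1..n}"
proof -
  have "replicate k 1 @ x_eps n @ w \<in> lists {1..n}" if "w \<in> lists {2..n}" for k w
    using assms lists_2_subset[OF that] x_eps_in_lists[of n] by (auto simp: in_lists_conv_set)
  then show ?thesis unfolding sorted_forms_def by blast
qed

lemma sorted_concat_replicate: "sorted (concat (map (\<lambda>i. replicate (m i) i) [a..<b :: nat]))"
  by (induction b) (auto simp: sorted_append)

lemma count_concat_replicate:
  "count (mset (concat (map (\<lambda>i. replicate (m i) i) [a..<b :: nat]))) j =
     (if a \<le> j \<and> j < b then m j else 0)"
  by (induction b) auto

lemma sorted_forms_eq_powers:
  "{replicate (m 1) 1 @ x_eps n @ concat (map (\<lambda>i. replicate (m i) i) [2..<Suc n])
      | m :: nat \<Rightarrow> nat. True} = sorted_forms n" (is "{?W m | m. True} = _")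
proof (intro equalityI subsetI)
  fix u assume "u \<in> {?W m | m. True}"
  then obtain m where "u = ?W m" by blast
  moreover have "concat (map (\<lambda>i. replicate (m i) i) [2..<Suc n]) \<in> lists {2..n}"
    by (auto simp: in_lists_conv_set simp del: upt_Suc)
  ultimately show "u \<in> sorted_forms n"
    unfolding sorted_forms_def using sorted_concat_replicate by blast
next
  fix u assume "u \<in> sorted_forms n"
  then obtain k w where u: "u = replicate k 1 @ x_eps n @ w" and w: "w \<in> lists {2..n}" "sorted w"
    unfolding sorted_forms_def by blast
  let ?m = "\<lambda>i. if i = 1 then k else count (mset w) i"
  let ?v = "concat (map (\<lambda>i. replicate (?m i) i) [2..<Suc n])"
  have "mset w = mset ?v"
  proof (rule multiset_eqI)
    fix j
    have "count (mset w) j = 0" if "\<not> (2 \<le> j \<and> j \<le> n)"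
      using w(1) that by (auto simp: in_lists_conv_set count_eq_zero_iff)
    then show "count (mset w) j = count (mset ?v) j"
      unfolding count_concat_replicate by auto
  qed
  then have "w = ?v"
    using w(2) sorted_concat_replicate by (metis properties_for_sort)
  then have "u = ?W ?m" unfolding u by simp
  then show "u \<in> {?W m | m. True}" by (intro CollectI exI[of _ ?m] conjI TrueI)
qed

text \<open>
  The letters of the two words are the same, so the exponents of $1$ are, and the sorted parts
  too.
\<close>

lemma sorted_forms_determined_by_mset:
  assumes "u \<in> sorted_forms n" "v \<in> sorted_forms n" "mset u = mset v"
  shows "u = v"
proof -
  obtain k w where u: "u = replicate k 1 @ x_eps n @ w" "w \<in> lists {2..n}" "sorted w"
    using assms(1) unfolding sorted_forms_def by blast
  obtain l y where v: "v = replicate l 1 @ x_eps n @ y" "y \<in> lists {2..n}" "sorted y"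
    using assms(2) unfolding sorted_forms_def by blast
  have eq: "replicate_mset k 1 + mset w = replicate_mset l 1 + mset y"
    using assms(3) by (simp add: u(1) v(1))
  have no1: "1 \<notin> set x" if "x \<in> lists {2..n}" for x
    using that by (auto simp: in_lists_conv_set)
  have "k = l"
    using arg_cong[OF eq, of "\<lambda>M. count M 1"] no1[OF u(2)] no1[OF v(2)]
    by (simp add: count_mset_0_iff[symmetric] del: count_mset_0_iff)
  with eq have "mset w = mset y" by simp
  with u(3) v(3) have "w = y" by (metis properties_for_sort)
  with \<open>k = l\<close> show ?thesis by (simp add: u(1) v(1))
qed

lemma cong_sorted_normal_form:
  assumes "u \<in> lists {1..n}" "has_perm_factor n u"
  obtains v where "v \<in> sorted_forms n" "u \<approx>\<^bsub>n\<^esub> v"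
proof -
  obtain a w b where u: "u = a @ w @ b" and w: "mset w = mset_set {1..n}"
    using assms(2) unfolding has_perm_factor_def by blast
  have ab: "a \<in> lists {1..n}" "b \<in> lists {1..n}" using assms(1) u by simp_all
  let ?k = "count (mset (a @ b)) 1" and ?s = "sort (filter (\<lambda>i. i \<noteq> 1) (a @ b))"
  let ?v = "replicate ?k 1 @ x_eps n @ ?s"
  have s: "?s \<in> lists {2..n}"
  proof -
    have "i \<in> {2..n}" if "i \<in> set ?s" for i
    proof -
      from that have "i \<in> set (a @ b)" "i \<noteq> 1" by auto
      with ab have "i \<in> {1..n}" "i \<noteq> 1" unfolding in_lists_conv_set by auto
      then show ?thesis by simp
    qed
    then show ?thesis unfolding in_lists_conv_set by blast
  qed
  moreover have "sorted ?s" by simp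
  ultimately have v: "?v \<in> sorted_forms n" unfolding sorted_forms_def by blast
  have ones: "replicate ?k 1 \<in> lists {1..n}"
  proof -
    have "1 \<in> {1..n}" if "?k \<noteq> 0"
    proof -
      from that have "1 \<in> set (a @ b)" by (simp only: count_mset_0_iff not_not)
      with ab show ?thesis unfolding in_lists_conv_set by auto
    qed
    then show ?thesis by (cases "?k = 0") (simp_all only: in_lists_conv_set set_replicate replicate_0, simp_all)
  qed
  have "u \<approx>\<^bsub>n\<^esub> a @ (x_eps n @ b)"
    unfolding u by (intro Sn_cong_append_left Sn_cong_append_right permutation_words_cong w mset_x_eps ab)
  also have "\<dots> = (a @ x_eps n) @ b" by simp
  also have "\<dots> \<approx>\<^bsub>n\<^esub> (x_eps n @ a) @ b"
    by (intro Sn_cong_append_right x_eps_commutes ab)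
  also have "\<dots> = x_eps n @ (a @ b)" by simp
  also have "\<dots> \<approx>\<^bsub>n\<^esub> x_eps n @ (replicate ?k 1 @ ?s)"
  proof (rule x_eps_rearrange)
    have "mset (replicate ?k 1 @ ?s) =
        filter_mset (\<lambda>i. i = 1) (mset (a @ b)) + filter_mset (\<lambda>i. i \<noteq> 1) (mset (a @ b))"
      by (simp only: mset_append mset_replicate mset_sort mset_filter filter_eq_replicate_mset)
    then show "mset (a @ b) = mset (replicate ?k 1 @ ?s)"
      by (simp only: multiset_partition[symmetric])
    show "a @ b \<in> lists {1..n}" using ab by simp
  qed
  also have "\<dots> = (x_eps n @ replicate ?k 1) @ ?s" by simp
  also have "\<dots> \<approx>\<^bsub>n\<^esub> (replicate ?k 1 @ x_eps n) @ ?s"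
    by (intro Sn_cong_append_right Sn_cong_sym[OF x_eps_commutes] ones lists_2_subset[OF s])
  also have "\<dots> = ?v" by simp
  finally have "u \<approx>\<^bsub>n\<^esub> ?v" .
  with v show ?thesis by (rule that)
qed

theorem ex1_normal_form:
  assumes "n \<ge> 1" "u \<in> lists {1..n}"
  shows "\<exists>!v. v \<in> {v \<in> lists {1..n}. \<not> has_perm_factor n v} \<union> sorted_forms n \<and> u \<approx>\<^bsub>n\<^esub> v"
    (is "\<exists>!v. v \<in> ?N \<and> _")
proof (rule ex_ex1I)
  show "\<exists>v. v \<in> ?N \<and> u \<approx>\<^bsub>n\<^esub> v"
  proof (cases "has_perm_factor n u")
    case True
    then show ?thesis using cong_sorted_normal_form[OF assms(2)] by blast
  next
    case False
    then show ?thesis using Sn_cong_refl[OF assms(2)] assms(2) by blast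
  qed
next
  fix v w assume v: "v \<in> ?N \<and> u \<approx>\<^bsub>n\<^esub> v" and w: "w \<in> ?N \<and> u \<approx>\<^bsub>n\<^esub> w"
  then have "v \<approx>\<^bsub>n\<^esub> w" using Sn_cong_sym Sn_cong_trans by blast
  from Sn_cong_cases[OF this] show "v = w"
  proof
    assume "has_perm_factor n v \<and> has_perm_factor n w \<and> mset v = mset w"
    with v w show "v = w" by (intro sorted_forms_determined_by_mset) blast+
  qed
qed


section \<open>Irreducible words\<close>

text \<open>
  This makes $z$ the least permutation word, and shows that each unsorted word occurs in the fourth
  family.
\<close>

lemma sorted_le_rearrangement:
  fixes u v :: "'a::linorder list"
  assumes "mset u = mset v" "sorted u"
  shows "u \<le> v"
  using assms
proof (induction u arbitrary: v)
  case Nil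
  then show ?case by simp
next
  case (Cons x u)
  then obtain y w where v: "v = y # w" by (cases v) auto
  have len: "length u = length w" using arg_cong[OF Cons.prems(1), of size] by (simp add: v)
  have "y \<in> set (x # u)" using arg_cong[OF Cons.prems(1), of set_mset] by (auto simp: v)
  with Cons.prems(2) have "x < y \<or> x = y" by auto
  then show ?case
  proof
    assume "x < y"
    then show ?thesis using len by (simp add: v Cons_le_Cons)
  next
    assume "x = y"
    moreover have "u \<le> w"
      using Cons.prems \<open>x = y\<close> by (intro Cons.IH) (simp_all add: v)
    ultimately show ?thesis using len by (simp add: v Cons_le_Cons)
  qed
qed

lemma leading_word_diff:
  assumes "v < u"
  shows "leading_word (mon u - mon v :: nat list \<Rightarrow>\<^sub>0 'k::field) = u"
proof -
  have "Poly_Mapping.keys (mon u - mon v :: nat list \<Rightarrow>\<^sub>0 'k) = {u, v}"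
    using assms by (auto simp: in_keys_iff lookup_minus lookup_single when_def split: if_splits)
  with assms show ?thesis by (simp add: leading_word_def max_absorb1)
qed

text \<open>
  Here the second and the third family are merged into one, with exponent $m \ge 0$.
\<close>

definition leading_words :: "nat \<Rightarrow> nat list set" where
  "leading_words n =
     {w. mset w = mset_set {1..n} \<and> w \<noteq> x_eps n} \<union>
     {[i] @ replicate m 1 @ x_eps n | i m. i \<in> {2..n}} \<union>
     {x_eps n @ w | w. w \<in> lists {2..n} \<and> length w \<ge> 2 \<and> w > sort w} \<union>
     {x_eps n @ w @ [1] | w. w \<in> lists {2..n} \<and> length w \<ge> 1}"

lemma leading_words_S_tilde:
  "leading_word ` (S_tilde n :: (nat list \<Rightarrow>\<^sub>0 'k::field) set) = leading_words n"
proof -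
  let ?d = "\<lambda>u v. mon u - mon v :: nat list \<Rightarrow>\<^sub>0 'k"
  have perm: "leading_word (?d w (x_eps n)) = w" if "mset w = mset_set {1..n}" "w \<noteq> x_eps n" for w
  proof (rule leading_word_diff)
    have "sorted (x_eps n)" by (simp add: x_word_def del: upt_Suc)
    then have "x_eps n \<le> w" using that(1) by (intro sorted_le_rearrangement) (simp_all add: mset_x_eps)
    with that(2) show "x_eps n < w" by simp
  qed
  have x_word_eq: "x_word n \<sigma> \<noteq> x_eps n" if "\<sigma> permutes {1..n}" "\<sigma> \<noteq> id" for \<sigma>
  proof
    assume "x_word n \<sigma> = x_eps n"
    then have "\<forall>i\<in>set [1..<Suc n]. \<sigma> i = id i" unfolding x_word_def map_eq_conv .
    then have "\<forall>i\<in>{1..n}. \<sigma> i = i" by (simp add: atLeastLessThanSuc_atLeastAtMost del: upt_Suc)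
    moreover have "\<sigma> i = i" if "i \<notin> {1..n}" for i
      using \<open>\<sigma> permutes {1..n}\<close> that by (rule permutes_not_in)
    ultimately have "\<sigma> = id" by (intro ext) (metis id_apply)
    with that(2) show False by contradiction
  qed
  have one: "leading_word (?d ([i] @ replicate m 1 @ x_eps n) (replicate m 1 @ x_eps n @ [i])) =
      [i] @ replicate m 1 @ x_eps n" if "i \<in> {2..n}" for i m
    using that by (intro leading_word_diff; cases m) (auto simp: x_eps_Cons Cons_less_Cons simp del: upt_Suc)
  have sort: "leading_word (?d (x_eps n @ w) (x_eps n @ sort w)) = x_eps n @ w" if "w > sort w" for w
    using that by (intro leading_word_diff) (simp add: list_less_def irrefl_def)
  have last: "leading_word (?d (x_eps n @ w @ [1]) ([1] @ x_eps n @ w)) = x_eps n @ w @ [1]"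
    if "w \<in> lists {2..n}" "length w \<ge> 1" for w
  proof (rule leading_word_diff)
    \<comment> \<open>The words first differ at the second letter, which is $1$ in one and $2$ in the other.\<close>
    have "n \<ge> 2" using that by (cases w) auto
    then have "x_eps n = 1 # 2 # [3..<Suc n]"
      by (simp add: x_word_def upt_conv_Cons numeral_2_eq_2 numeral_3_eq_3 del: upt_Suc)
    then show "[1] @ x_eps n @ w < x_eps n @ w @ [1]" by (simp add: Cons_less_Cons del: upt_Suc)
  qed
  show ?thesis
  proof (intro equalityI subsetI)
    fix u assume "u \<in> leading_word ` (S_tilde n :: (nat list \<Rightarrow>\<^sub>0 'k) set)"
    then obtain s where s: "s \<in> (S_tilde n :: (nat list \<Rightarrow>\<^sub>0 'k) set)" "u = leading_word s" by blast
    from s(1) consider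
        \<sigma> where "\<sigma> permutes {1..n}" "\<sigma> \<noteq> id" "s = ?d (x_word n \<sigma>) (x_eps n)"
      | i where "i \<in> {2..n}" "s = ?d ([i] @ x_eps n) (x_eps n @ [i])"
      | i m where "i \<in> {2..n}"
          "s = ?d ([i] @ replicate m 1 @ x_eps n) (replicate m 1 @ x_eps n @ [i])"
      | w where "w \<in> lists {2..n}" "length w \<ge> 2" "w > sort w"
          "s = ?d (x_eps n @ w) (x_eps n @ sort w)"
      | w where "w \<in> lists {2..n}" "length w \<ge> 1"
          "s = ?d (x_eps n @ w @ [1]) ([1] @ x_eps n @ w)"
      unfolding S_tilde_def by (elim UnE CollectE exE conjE) blast+
    then show "u \<in> leading_words n"
    proof cases
      case 1
      then have "mset (x_word n \<sigma>) = mset_set {1..n} \<and> x_word n \<sigma> \<noteq> x_eps n"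
        using mset_x_word x_word_eq by blast
      with 1(3) s(2) perm show ?thesis unfolding leading_words_def by auto
    next
      case 2
      then have "u = [i] @ replicate 0 1 @ x_eps n" using one[of i 0] s(2) by simp
      with 2(1) show ?thesis unfolding leading_words_def by blast
    next
      case 3
      then have "u = [i] @ replicate m 1 @ x_eps n" using one[of i m] s(2) by simp
      with 3(1) show ?thesis unfolding leading_words_def by blast
    next
      case 4
      then have "u = x_eps n @ w" using sort s(2) by simp
      with 4 show ?thesis unfolding leading_words_def by blast
    next
      case 5
      then have "u = x_eps n @ w @ [1]" using last s(2) by simp
      with 5 show ?thesis unfolding leading_words_def by blast
    qed
  next
    fix u assume "u \<in> leading_words n"
    then consider
        "mset u = mset_set {1..n}" "u \<noteq> x_eps n"
      | i m where "i \<in> {2..n}" "u = [i] @ replicate m 1 @ x_eps n"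
      | w where "w \<in> lists {2..n}" "length w \<ge> 2" "w > sort w" "u = x_eps n @ w"
      | w where "w \<in> lists {2..n}" "length w \<ge> 1" "u = x_eps n @ w @ [1]"
      unfolding leading_words_def by blast
    then have "\<exists>s\<in>S_tilde n :: (nat list \<Rightarrow>\<^sub>0 'k) set. leading_word s = u"
    proof cases
      case 1
      obtain \<sigma> where \<sigma>: "\<sigma> permutes {1..n}" "u = x_word n \<sigma>"
        using 1(1) by (rule permutation_word_is_x_word)
      moreover have "\<sigma> \<noteq> id" using \<sigma>(2) 1(2) by blast
      ultimately have "?d u (x_eps n) \<in> S_tilde n" unfolding S_tilde_def by blast
      with perm[OF 1] show ?thesis by blast
    next
      case 2
      have "?d u (replicate m 1 @ x_eps n @ [i]) \<in> S_tilde n"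
      proof (cases "m = 0")
        case True
        with 2(2) have "?d u (replicate m 1 @ x_eps n @ [i]) = ?d ([i] @ x_eps n) (x_eps n @ [i])"
          by simp
        with 2(1) show ?thesis unfolding S_tilde_def by blast
      next
        case False
        then have "m \<ge> 1" by simp
        with 2 show ?thesis unfolding S_tilde_def by blast
      qed
      with one[OF 2(1), of m] 2(2) show ?thesis by blast
    next
      case 3
      then have "?d u (x_eps n @ sort w) \<in> S_tilde n" unfolding S_tilde_def by blast
      with sort[OF 3(3)] 3(4) show ?thesis by blast
    next
      case 4
      then have "?d u ([1] @ x_eps n @ w) \<in> S_tilde n" unfolding S_tilde_def by blast
      with last[OF 4(1,2)] 4(3) show ?thesis by blast
    qed
    then show "u \<in> leading_word ` (S_tilde n :: (nat list \<Rightarrow>\<^sub>0 'k) set)" by blast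
  qed
qed

lemma Irr_S_tilde_iff:
  "u \<in> Irr n (S_tilde n :: (nat list \<Rightarrow>\<^sub>0 'k::field) set) \<longleftrightarrow>
     u \<in> lists {1..n} \<and> (\<forall>s\<in>leading_words n. \<forall>a b. u \<noteq> a @ s @ b)"
proof -
  have "a \<in> lists {1..n} \<and> b \<in> lists {1..n}" if "u \<in> lists {1..n}" "u = a @ s @ b" for a b s
    using that by simp
  then show ?thesis
    unfolding Irr_def leading_words_S_tilde[symmetric, where 'k = 'k] by blast
qed

lemma leading_words_have_perm_factor:
  assumes "s \<in> leading_words n"
  shows "has_perm_factor n s"
proof -
  consider "mset s = mset_set {1..n}" | a b where "s = a @ x_eps n @ b"
    using assms unfolding leading_words_def by (auto, (metis append_Cons append_Nil append_Nil2)+)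
  then show ?thesis
  proof cases
    case 1
    then show ?thesis unfolding has_perm_factor_def by (metis append_Nil append_Nil2)
  next
    case 2
    then show ?thesis using has_perm_factor_x_eps by simp
  qed
qed

text \<open>
  On the left the last $1$ is the end of the initial power. The displayed $1$ on the right must be
  the same one: the letter that follows it, the first one of \<^term>\<open>x\<close>, is different from $1$.
\<close>

lemma factor_after_ones:
  assumes "replicate k 1 @ v = a @ 1 # x @ b" "x \<noteq> []" "(1::nat) \<notin> set x" "1 \<notin> set v"
  shows "\<exists>l. a = replicate l 1 \<and> v = x @ b"
  using assms(1)
proof (induction k arbitrary: a)
  case 0
  then have "1 \<in> set v" by simp
  with assms(4) show ?case by contradiction
next
  case (Suc k)
  show ?case
  proof (cases a)
    case Nil
    with Suc.prems have eq: "replicate k 1 @ v = x @ b" by simp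
    have "k = 0"
    proof (rule ccontr)
      assume "k \<noteq> 0"
      with eq assms(2) have "1 \<in> set x" by (cases k; cases x) auto
      with assms(3) show False by contradiction
    qed
    with eq Nil show ?thesis by (intro exI[of _ 0]) simp
  next
    case (Cons c a')
    with Suc.prems have "1 # (replicate k 1 @ v) = c # (a' @ 1 # x @ b)"
      by (simp only: replicate_Suc append_Cons)
    then have "c = 1" and "replicate k 1 @ v = a' @ 1 # x @ b" by (simp_all only: list.inject)
    with Suc.IH obtain l where "a' = replicate l 1" "v = x @ b" by blast
    with Cons \<open>c = 1\<close> show ?thesis by (intro exI[of _ "Suc l"]) simp
  qed
qed

lemma ones_before_one:
  assumes "replicate k 1 @ v = a @ (1::nat) # c" "1 \<notin> set v"
  shows "set a \<subseteq> {1}"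
  using assms(1)
proof (induction k arbitrary: a)
  case 0
  then have "1 \<in> set v" by simp
  with assms(2) show ?case by contradiction
next
  case (Suc k)
  then show ?case by (cases a) auto
qed

text \<open>
  In $1^k z w$ every letter before a $1$ is a $1$ itself. This excludes the leading words
  $i 1^m z$, and also $z y 1$, since the nonempty word $y$ has letters other than $1$. A permutation
  factor can only begin at a $1$, and if another letter follows in it, this is the last $1$, where
  $z$ begins. So the factor is $z$; and a word $y$ that follows it, if it is nonempty and does not
  contain $1$, is an initial part of the sorted word $w$, hence sorted.
\<close>

lemma sorted_forms_avoid_leading_words:
  assumes "n \<ge> 1" "u \<in> sorted_forms n" "s \<in> leading_words n"
  shows "u \<noteq> a @ s @ b"
proof
  assume eq: "u = a @ s @ b"
  obtain k w where u: "u = replicate k 1 @ x_eps n @ w" and w: "w \<in> lists {2..n}" "sorted w"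
    using assms(2) unfolding sorted_forms_def by blast
  let ?v = "[2..<Suc n] @ w"
  have u': "u = replicate (Suc k) 1 @ ?v"
    unfolding u x_eps_Cons[OF assms(1)] by (simp add: replicate_append_same[symmetric] del: upt_Suc)
  have no1: "1 \<notin> set ?v" using w(1) by (auto simp: in_lists_conv_set simp del: upt_Suc)
  have before: "set c \<subseteq> {1}" if "u = c @ 1 # d" for c d
    using ones_before_one[OF _ no1] that u' by metis
  have after: "?v = x @ d" if "u = c @ 1 # x @ d" "x \<noteq> []" "1 \<notin> set x" for c x d
    using factor_after_ones[OF _ that(2,3) no1] that(1) u' by metis
  from assms(3) consider
      "mset s = mset_set {1..n}" "s \<noteq> x_eps n"
    | i m where "i \<in> {2..n}" "s = [i] @ replicate m 1 @ x_eps n"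
    | y where "y \<in> lists {2..n}" "length y \<ge> 2" "y > sort y" "s = x_eps n @ y"
    | y where "y \<in> lists {2..n}" "length y \<ge> 1" "s = x_eps n @ y @ [1]"
    unfolding leading_words_def by blast
  then show False
  proof cases
    case 1
    have "distinct s" using 1(1) by (metis mset_x_eps distinct_upt x_word_def list.map_id mset_eq_imp_distinct_iff)
    have "set s = {1..n}" using arg_cong[OF 1(1), of set_mset] by simp
    with assms(1) have "1 \<in> set s" by simp
    then obtain p q where pq: "s = p @ 1 # q" by (meson split_list)
    have "set (a @ p) \<subseteq> {1}" by (rule before[of _ "q @ b"]) (simp add: eq pq)
    with \<open>distinct s\<close> have "p = []" unfolding pq by (cases p) auto
    have len: "length s = n" using arg_cong[OF 1(1), of size] by simp
    have "s = x_eps n"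
    proof (cases "q = []")
      case True
      with len \<open>p = []\<close> pq assms(1) show ?thesis by (simp add: x_word_def)
    next
      case False
      have "?v = q @ b"
        using \<open>distinct s\<close> False by (intro after[of a]) (simp_all add: eq pq \<open>p = []\<close>)
      then have "take (n - 1) ?v = take (n - 1) (q @ b)" by simp
      moreover have "length q = n - 1" using len by (simp add: pq \<open>p = []\<close>)
      ultimately have "[2..<Suc n] = q" by (simp del: upt_Suc)
      then show ?thesis unfolding x_eps_Cons[OF assms(1)] pq \<open>p = []\<close> by simp
    qed
    with 1(2) show False by contradiction
  next
    case 2
    then have "u = (a @ [i] @ replicate m 1) @ 1 # [2..<Suc n] @ b"
      using assms(1) by (simp add: eq x_eps_Cons del: upt_Suc)
    then have "set (a @ [i] @ replicate m 1) \<subseteq> {1}" by (rule before)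
    with 2(1) show False by simp
  next
    case 3
    have "?v = ([2..<Suc n] @ y) @ b"
      using 3 assms(1)
      by (intro after[of a]) (auto simp: eq x_eps_Cons in_lists_conv_set simp del: upt_Suc)
    then have "w = y @ b" by simp
    with w(2) have "sort y = y" by (simp add: sorted_append sorted_sort_id)
    with 3(3) show False by simp
  next
    case 4
    then have "u = (a @ x_eps n @ y) @ 1 # b" by (simp add: eq)
    then have "set (a @ x_eps n @ y) \<subseteq> {1}" by (rule before)
    moreover obtain i where "i \<in> set y" using 4(2) by (cases y) auto
    ultimately have "i = 1" by auto
    with \<open>i \<in> set y\<close> 4(1) show False by (auto simp: in_lists_conv_set)
  qed
qed

text \<open>
  In $azb$, the last letter of $a$ other than $1$ would begin a leading word of the second or third
  family. For $n \ge 2$, the first $1$ in $b$ would end one of the fifth family or, right behind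
  $z$, one of the first.
\<close>

lemma irreducible_with_perm_factor:
  assumes "n \<ge> 1" "u \<in> lists {1..n}" "has_perm_factor n u"
    and avoid: "\<And>s a b. s \<in> leading_words n \<Longrightarrow> u \<noteq> a @ s @ b"
  shows "u \<in> sorted_forms n"
proof -
  obtain a s b where u: "u = a @ s @ b" and s: "mset s = mset_set {1..n}"
    using assms(3) unfolding has_perm_factor_def by blast
  have "s = x_eps n"
    using avoid[of s a b] u s unfolding leading_words_def by blast
  with u have u: "u = a @ x_eps n @ b" by simp
  have a: "set a \<subseteq> {1}"
  proof (rule ccontr)
    assume "\<not> set a \<subseteq> {1}"
    then obtain c i d where split: "a = c @ i # d" "i \<noteq> 1" "\<forall>j\<in>set d. j = 1"
      using split_list_last_prop[of a "\<lambda>i. i \<noteq> 1"] by blast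
    then have d: "d = replicate (length d) 1" by (simp add: replicate_length_same)
    have "i \<in> {1..n}" using assms(2) u split(1) by simp
    with split(2) have "i \<in> {2..n}" by simp
    then have "[i] @ d @ x_eps n \<in> leading_words n"
      unfolding leading_words_def using d by blast
    from avoid[OF this, of c b] show False by (simp add: u split(1))
  qed
  show ?thesis
  proof (cases "n = 1")
    case True
    \<comment> \<open>The monoid is free on one letter, $z$ is that letter, and no letter can follow it in the form
      $1^k z w$.\<close>
    have "u = replicate (length a + length b) 1 @ x_eps n @ []"
    proof -
      have "set u \<subseteq> {1}" using assms(2) True by (auto simp: in_lists_conv_set)
      then have "u = replicate (length u) 1" by (metis replicate_length_same singletonD subsetD)
      moreover have "length u = Suc (length a + length b)" using True u by (simp add: x_word_def)
      ultimately show ?thesis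
        using True by (simp add: x_word_def replicate_append_same)
    qed
    then show ?thesis unfolding sorted_forms_def by fastforce
  next
    case False
    with assms(1) have n: "n \<ge> 2" by simp
    have b1: "1 \<notin> set b"
    proof
      assume "1 \<in> set b"
      then obtain c d where b: "b = c @ 1 # d" "1 \<notin> set c" by (meson split_list_first)
      have c: "c \<in> lists {2..n}"
      proof -
        have "j \<in> {2..n}" if "j \<in> set c" for j
        proof -
          have "j \<in> {1..n}" using assms(2) u b(1) that by (auto simp: in_lists_conv_set)
          moreover have "j \<noteq> 1" using that b(2) by blast
          ultimately show ?thesis by simp
        qed
        then show ?thesis by auto
      qed
      show False
      proof (cases "c = []")
        case True
        \<comment> \<open>Dropping the first letter of $z1$ leaves the permutation word $2 \cdots n 1$.\<close>
        let ?s = "[2..<Suc n] @ [1]"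
        have "mset ?s = mset (x_eps n)" using assms(1) by (simp add: x_eps_Cons del: upt_Suc)
        moreover have "?s \<noteq> x_eps n"
        proof -
          have "hd ?s = 2" using n by (simp add: upt_conv_Cons del: upt_Suc)
          moreover have "hd (x_eps n) = 1" using assms(1) by (simp add: x_eps_Cons)
          ultimately show ?thesis by (metis numeral_eq_one_iff semiring_norm(85))
        qed
        ultimately have "?s \<in> leading_words n"
          unfolding leading_words_def mset_x_eps by blast
        from avoid[OF this, of "a @ [1]" d] show False
          using assms(1) by (simp add: u b(1) True x_eps_Cons del: upt_Suc)
      next
        case False
        then have "length c \<ge> 1" by (cases c) auto
        with c have "x_eps n @ c @ [1] \<in> leading_words n" unfolding leading_words_def by blast
        from avoid[OF this, of a d] show False by (simp add: u b(1))
      qed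
    qed
    have b: "b \<in> lists {2..n}"
    proof -
      have "j \<in> {2..n}" if "j \<in> set b" for j
      proof -
        have "j \<in> {1..n}" using assms(2) u that by (auto simp: in_lists_conv_set)
        moreover have "j \<noteq> 1" using that b1 by blast
        ultimately show ?thesis by simp
      qed
      then show ?thesis by auto
    qed
    have "sorted b"
    proof (rule ccontr)
      assume unsorted: "\<not> sorted b"
      then have "sort b \<noteq> b" by (metis sorted_sort)
      moreover have "sort b \<le> b" by (rule sorted_le_rearrangement) simp_all
      ultimately have "b > sort b" by simp
      moreover have "length b \<ge> 2" using unsorted by (cases b; cases "tl b") auto
      ultimately have "x_eps n @ b \<in> leading_words n"
        using b unfolding leading_words_def by blast
      from avoid[OF this, of a "[]"] show False by (simp add: u)
    qed
    moreover have "a = replicate (length a) 1" using a by (metis replicate_length_same singletonD subsetD)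
    ultimately show ?thesis unfolding sorted_forms_def u using b by blast
  qed
qed

lemma Irr_S_tilde_eq:
  assumes "n \<ge> 1"
  shows "Irr n (S_tilde n :: (nat list \<Rightarrow>\<^sub>0 'k::field) set) =
    {u \<in> lists {1..n}. \<not> has_perm_factor n u} \<union> sorted_forms n"
proof (intro equalityI subsetI)
  fix u assume "u \<in> Irr n (S_tilde n :: (nat list \<Rightarrow>\<^sub>0 'k) set)"
  then have u: "u \<in> lists {1..n}" "\<And>s a b. s \<in> leading_words n \<Longrightarrow> u \<noteq> a @ s @ b"
    unfolding Irr_S_tilde_iff by blast+
  then show "u \<in> {u \<in> lists {1..n}. \<not> has_perm_factor n u} \<union> sorted_forms n"
    using irreducible_with_perm_factor[OF assms] by blast
next
  fix u assume u: "u \<in> {u \<in> lists {1..n}. \<not> has_perm_factor n u} \<union> sorted_forms n"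
  then have "u \<noteq> a @ s @ b" if "s \<in> leading_words n" for s a b
    using sorted_forms_avoid_leading_words[OF assms _ that] has_perm_factor_append
      leading_words_have_perm_factor[OF that] by blast
  moreover have "u \<in> lists {1..n}" using u sorted_forms_subset[OF assms] by blast
  ultimately show "u \<in> Irr n (S_tilde n :: (nat list \<Rightarrow>\<^sub>0 'k) set)"
    unfolding Irr_S_tilde_iff by blast
qed


section \<open>The basis of a monoid algebra\<close>

lemma inj_mon: "inj (mon :: 'm \<Rightarrow> 'm \<Rightarrow>\<^sub>0 'k::field)"
proof (rule injI)
  fix a b :: 'm
  assume "mon a = (mon b :: 'm \<Rightarrow>\<^sub>0 'k)"
  then have "Poly_Mapping.keys (mon a :: 'm \<Rightarrow>\<^sub>0 'k) = Poly_Mapping.keys (mon b :: 'm \<Rightarrow>\<^sub>0 'k)" by simp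
  then show "a = b" by simp
qed

lemma independent_mon: "pm.independent (mon ` A :: ('m \<Rightarrow>\<^sub>0 'k::field) set)"
  unfolding pm.independent_explicit_finite_subsets
proof (intro allI impI ballI)
  fix T :: "('m \<Rightarrow>\<^sub>0 'k) set" and c v
  assume T: "T \<subseteq> mon ` A" "finite T" and zero: "(\<Sum>v\<in>T. pm_scale (c v) v) = 0" and v: "v \<in> T"
  from T(1) v obtain a where a: "v = mon a" by blast
  \<comment> \<open>The coefficient of the sum at \<^term>\<open>a\<close> comes from \<^term>\<open>mon a\<close> alone.\<close>
  have coeff: "c w * Poly_Mapping.lookup w a = (if w = v then c v else 0)" if "w \<in> T" for w
  proof -
    have v_eq: "mon b = v \<longleftrightarrow> b = a" for b unfolding a using inj_mon by (rule inj_eq)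
    from T(1) that obtain b where "w = mon b" by blast
    then show ?thesis using v_eq[of b] by (auto simp: lookup_single when_def)
  qed
  have "0 = (\<Sum>w\<in>T. c w * Poly_Mapping.lookup w a)"
    using arg_cong[OF zero, of "\<lambda>f. Poly_Mapping.lookup f a"] by (simp add: lookup_sum lookup_pm_scale)
  also have "\<dots> = c v" using T(2) v by (simp add: coeff)
  finally show "c v = 0" by simp
qed

lemma span_mon:
  "pm.span (mon ` carrier M) = carrier (monoid_algebra M :: ('k::field, 'm \<Rightarrow>\<^sub>0 'k) module)"
proof (intro equalityI)
  show "pm.span (mon ` carrier M) \<subseteq> carrier (monoid_algebra M :: ('k, 'm \<Rightarrow>\<^sub>0 'k) module)"
    by (rule pm.span_minimal[OF _ subspace_monoid_algebra]) (auto simp: monoid_algebra_def)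
  show "carrier (monoid_algebra M :: ('k, 'm \<Rightarrow>\<^sub>0 'k) module) \<subseteq> pm.span (mon ` carrier M)"
  proof
    fix f assume "f \<in> carrier (monoid_algebra M :: ('k, 'm \<Rightarrow>\<^sub>0 'k) module)"
    then have keys: "Poly_Mapping.keys f \<subseteq> carrier M" by (simp add: monoid_algebra_def)
    have "f = (\<Sum>a\<in>Poly_Mapping.keys f. pm_scale (Poly_Mapping.lookup f a) (mon a))"
      by (intro poly_mapping_eqI)
         (auto simp: lookup_sum lookup_pm_scale lookup_single when_def in_keys_iff if_distrib cong: if_cong)
    also have "\<dots> \<in> pm.span (mon ` carrier M)"
      using keys by (intro pm.span_sum pm.span_scale pm.span_base) blast
    finally show "f \<in> pm.span (mon ` carrier M)" .
  qed
qed

theorem corollary3p3: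
  fixes n :: nat
  assumes "n \<ge> 1"
  shows "Irr n (S_tilde n :: (nat list \<Rightarrow>\<^sub>0 'k::field) set) =
      (lists {1..n} -
        (\<Union>\<sigma>\<in>{\<sigma>. \<sigma> permutes {1..n}}.
           {a @ x_word n \<sigma> @ b | a b. a \<in> lists {1..n} \<and> b \<in> lists {1..n}})) \<union>
      {replicate (m 1) 1 @ x_eps n @ concat (map (\<lambda>i. replicate (m i) i) [2..<Suc n])
        | m :: nat \<Rightarrow> nat. True}
    \<and> inj_on (\<lambda>u. mon (Sn_class n u) :: nat list set \<Rightarrow>\<^sub>0 'k)
        (Irr n (S_tilde n :: (nat list \<Rightarrow>\<^sub>0 'k) set))
    \<and> pm.independent ((\<lambda>u. mon (Sn_class n u) :: nat list set \<Rightarrow>\<^sub>0 'k) `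
        Irr n (S_tilde n :: (nat list \<Rightarrow>\<^sub>0 'k) set))
    \<and> pm.span ((\<lambda>u. mon (Sn_class n u) :: nat list set \<Rightarrow>\<^sub>0 'k) `
        Irr n (S_tilde n :: (nat list \<Rightarrow>\<^sub>0 'k) set)) =
      carrier (monoid_algebra (Sn_Sym n) :: ('k, nat list set \<Rightarrow>\<^sub>0 'k) module)
    \<and> (\<forall>s\<in>carrier (Sn_Sym n).
        \<exists>!u. u \<in> Irr n (S_tilde n :: (nat list \<Rightarrow>\<^sub>0 'k) set) \<and> Sn_class n u = s)"
proof -
  let ?I = "Irr n (S_tilde n :: (nat list \<Rightarrow>\<^sub>0 'k) set)"
  let ?m = "\<lambda>u. mon (Sn_class n u) :: nat list set \<Rightarrow>\<^sub>0 'k"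
  have I: "?I \<subseteq> lists {1..n}" unfolding Irr_def by blast
  have class_eq: "Sn_class n u = Sn_class n v \<longleftrightarrow> u \<approx>\<^bsub>n\<^esub> v"
    if "u \<in> lists {1..n}" "v \<in> lists {1..n}" for u v
    unfolding Sn_class_def Sn_cong_def by (rule word_class_eq_iff[OF that])
  have normal: "\<exists>!u. u \<in> ?I \<and> Sn_class n u = s" if s: "s \<in> carrier (Sn_Sym n)" for s
  proof -
    obtain v where v: "v \<in> lists {1..n}" "s = Sn_class n v"
      using s unfolding Sn_Sym_def Sn_class_def by (rule presented_monoid_cases)
    have "u \<in> ?I \<and> Sn_class n u = s \<longleftrightarrow> u \<in> ?I \<and> v \<approx>\<^bsub>n\<^esub> u" for u
      using class_eq[OF v(1), of u] I v(2) by auto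
    then show ?thesis
      using ex1_normal_form[OF assms v(1)] unfolding Irr_S_tilde_eq[OF assms, where 'k = 'k] by simp
  qed
  have classes: "Sn_class n u \<in> carrier (Sn_Sym n)" if "u \<in> ?I" for u
    unfolding Sn_Sym_def Sn_class_def using that I by (intro word_class_in_carrier) blast
  have inj: "inj_on (Sn_class n) ?I"
    using normal classes by (intro inj_onI) metis
  have "Sn_class n ` ?I = carrier (Sn_Sym n)"
    using normal classes by blast
  then have image: "?m ` ?I = mon ` carrier (Sn_Sym n)"
    using image_image[of mon "Sn_class n" ?I] by metis
  have "inj_on ?m ?I"
    using comp_inj_on[OF inj inj_on_subset[OF inj_mon subset_UNIV]] by (simp only: comp_def)
  moreover have "pm.independent (?m ` ?I)"
    unfolding image by (rule independent_mon)
  moreover have "pm.span (?m ` ?I) = carrier (monoid_algebra (Sn_Sym n))"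
    unfolding image by (rule span_mon)
  ultimately show ?thesis
    unfolding words_without_perm_factor sorted_forms_eq_powers using Irr_S_tilde_eq[OF assms] normal
    by blast
qed

end
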